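(* There exist absolute constants $c, C_1, C_2 > 0$ such that for every number of cups $n$ and every positive integer $k \le c\cdot n$, the filler in the variable-processor cup game on $n$ cups (starting from all fills $0$) has a strategy which, against every emptying strategy, guarantees that the backlog is at least $C_1 k$ within at most $C_2\left(k + \frac{k^3}{\log^2(n/k)}\right)$ rounds.
   Context: The (standard) variable-processor cup game on $n$ cups: there are $n$ cups with real fills $x_1,\dots,x_n$, all initially $0$, and two adaptive players (each sees the full current state), a filler and an emptier. In each round the filler chooses an integer $1\le p\le n$ and reals $a_1,\dots,a_n\in[0,1]$ with $\sum_i a_i = p$, and replaces each $x_i$ by $x_i+a_i$; then the emptier chooses a set $S\subseteq[n]$ of exactly $p$ cups and replaces $x_i$ by $\max(0,x_i-1)$ for each $i\in S$. The backlog of a state is $\max_i x_i$. The filler wants to maximize the backlog, the emptier to minimize it. *)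

theory Defs
  imports Complex_Main
begin

text \<open>Variable-processor cup game on n cups (indices 0..n-1).
  A state assigns a fill to each cup; only indices below n matter.\<close>

type_synonym state = "nat \<Rightarrow> real"

text \<open>A filler move is a pair (p, a): number of processors p and fill amounts a.\<close>
type_synonym fmove = "nat \<times> (nat \<Rightarrow> real)"

definition valid_fill :: "nat \<Rightarrow> fmove \<Rightarrow> bool" where
  "valid_fill n m \<longleftrightarrow> (case m of (p, a) \<Rightarrow>
     1 \<le> p \<and> p \<le> n \<and> (\<forall>i<n. 0 \<le> a i \<and> a i \<le> 1) \<and> (\<Sum>i<n. a i) = real p)"

definition valid_empty :: "nat \<Rightarrow> nat \<Rightarrow> nat set \<Rightarrow> bool" where
  "valid_empty n p S \<longleftrightarrow> S \<subseteq> {..<n} \<and> card S = p"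

definition fill_step :: "state \<Rightarrow> (nat \<Rightarrow> real) \<Rightarrow> state" where
  "fill_step x a = (\<lambda>i. x i + a i)"

definition empty_step :: "state \<Rightarrow> nat set \<Rightarrow> state" where
  "empty_step x S = (\<lambda>i. if i \<in> S then max 0 (x i - 1) else x i)"

definition backlog :: "nat \<Rightarrow> state \<Rightarrow> real" where
  "backlog n x = Max (x ` {..<n})"

text \<open>Strategies are fully adaptive: they see the whole history of states
  (most recent state first); the emptier additionally sees the filler's current move.\<close>
type_synonym filler_strategy = "state list \<Rightarrow> fmove"
type_synonym emptier_strategy = "state list \<Rightarrow> fmove \<Rightarrow> nat set"

definition filler_ok :: "nat \<Rightarrow> filler_strategy \<Rightarrow> bool" where
  "filler_ok n F \<longleftrightarrow> (\<forall>h. valid_fill n (F h))"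

definition emptier_ok :: "nat \<Rightarrow> emptier_strategy \<Rightarrow> bool" where
  "emptier_ok n E \<longleftrightarrow> (\<forall>h m. valid_fill n m \<longrightarrow> valid_empty n (fst m) (E h m))"

fun play :: "filler_strategy \<Rightarrow> emptier_strategy \<Rightarrow> nat \<Rightarrow> state list" where
  "play F E 0 = [(\<lambda>_. 0)]"
| "play F E (Suc t) =
     (let h = play F E t; m = F h
      in empty_step (fill_step (hd h) (snd m)) (E h m) # h)"

end

theory Submission
  imports Defs
begin

text \<open>
  The filler keeps all fills half-integral and measures a state by the excesses
  $A_j = \sum_i \max(0, 2x_i - j)$ for $j \ge 0$. For a level $h$ it may pour 1 into every cup
  above $h/2$ and $1/2$ into an even number of cups at exactly $h/2$. Whatever the emptier does, no
  $A_j$ drops, and $A_h$ grows by half the number of cups at $h/2$. That number is the second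
  difference of $A$ at $h$, so the guaranteed new value of $A_h$ is
  $\lfloor (A_{h-1} + A_{h+1})/2 \rfloor$, which is monotone in $A$. It thus suffices to run a
  deterministic discrete heat flow in which one site is updated per round; the boundary
  condition is $A_{-1} = A_0 + n$.

  By convexity, as long as the heat has not spread over a window of width $w$, some site of the
  window has large curvature, and updating it makes the total heat grow noticeably. Hence $O(w^3)$
  updates give $A_w \ge nw/2$, and another $O(w^3)$ updates carry a quarter of the value at any
  site $l$ to the site $l + w$, while this value is at least $8w^2$. With
  $r \approx \log(n/k)$ such transports and $w \approx k/r$ the site $k$ gets positive heat
  after $O(r w^3) = O(k^3/r^2)$ rounds.
\<close>

section \<open>The heat flow\<close>

text \<open>The value at 0 is the drop from a fictitious site -1 that carries
  \<open>b 0 + n\<close>.\<close>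

definition slope :: "nat \<Rightarrow> (nat \<Rightarrow> int) \<Rightarrow> nat \<Rightarrow> int" where
  "slope n b h = (case h of 0 \<Rightarrow> int n | Suc j \<Rightarrow> b j - b (Suc j))"

definition curvature :: "nat \<Rightarrow> (nat \<Rightarrow> int) \<Rightarrow> nat \<Rightarrow> int" where
  "curvature n b h = slope n b h - slope n b (Suc h)"

text \<open>The new value is the floor of the mean of the two neighbours; for \<open>h = 0\<close>
  the fictitious site -1 is the left one.\<close>

definition bump :: "nat \<Rightarrow> nat \<Rightarrow> (nat \<Rightarrow> int) \<Rightarrow> nat \<Rightarrow> int" where
  "bump n h b = b(h := b h + curvature n b h div 2)"

definition convex_profile :: "nat \<Rightarrow> (nat \<Rightarrow> int) \<Rightarrow> bool" where
  "convex_profile n b \<longleftrightarrow> (\<forall>h. 0 \<le> b h \<and> 0 \<le> slope n b h \<and> 0 \<le> curvature n b h)"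

lemma slope_0 [simp]: "slope n b 0 = int n"
  and slope_Suc [simp]: "slope n b (Suc j) = b j - b (Suc j)"
  by (simp_all add: slope_def)

text \<open>The old \<open>b h\<close> cancels against the curvature, so the new value is the floor
  of an increasing expression in the neighbours. At site 0 the boundary brings \<open>b 0\<close>
  back, but with positive weight.\<close>

lemma bump_mono:
  assumes "\<And>j. b j \<le> b' j"
  shows "bump n h b j \<le> bump n h b' j"
proof (cases h)
  case 0
  have "b 0 + (int n - (b 0 - b 1)) div 2 \<le> b' 0 + (int n - (b' 0 - b' 1)) div 2"
    using assms[of 0] assms[of 1] by presburger
  then show ?thesis
    using assms 0 by (simp add: bump_def curvature_def)
next
  case (Suc i)
  have "b h + (b i - b h - (b h - b (Suc h))) div 2
      \<le> b' h + (b' i - b' h - (b' h - b' (Suc h))) div 2"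
    using assms[of i] assms[of h] assms[of "Suc h"] by presburger
  then show ?thesis
    using assms Suc by (simp add: bump_def curvature_def)
qed

lemma slope_bump:
  "slope n (bump n h b) j = slope n b j
     + (if j = Suc h then curvature n b h div 2 else 0)
     - (if j = h \<and> h \<noteq> 0 then curvature n b h div 2 else 0)"
  unfolding bump_def by (cases j) auto

text \<open>With \<open>g\<close> half the curvature, rounded down, the slope at \<open>h\<close>
  falls by \<open>g\<close> (for \<open>h = 0\<close> it stays \<open>n\<close>) and the slope at
  \<open>Suc h\<close> rises by \<open>g\<close>. As \<open>2 * g\<close> is at most their gap, they
  do not cross, and the neighbouring curvatures do not decrease.\<close>

lemma convex_profile_bump:
  assumes "convex_profile n b"
  shows "convex_profile n (bump n h b)"
  unfolding convex_profile_def
proof (intro allI conjI)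
  have b: "0 \<le> b j" "0 \<le> slope n b j" "slope n b (Suc j) \<le> slope n b j" for j
    using assms by (auto simp: convex_profile_def curvature_def simp del: slope_Suc)
  define g where "g = curvature n b h div 2"
  have g: "0 \<le> g" "2 * g \<le> slope n b h - slope n b (Suc h)"
    using b(3)[of h] by (auto simp: g_def curvature_def simp del: slope_Suc)
  fix j
  show "0 \<le> bump n h b j"
    using b(1) g(1) by (simp add: bump_def g_def)
  show "0 \<le> slope n (bump n h b) j"
    using b(2)[of j] b(2)[of "Suc h"] g by (auto simp: slope_bump simp flip: g_def simp del: slope_Suc)
  show "0 \<le> curvature n (bump n h b) j"
    using b(3)[of j] g
    unfolding curvature_def slope_bump g_def[symmetric]
    by (auto simp del: slope_Suc)
qed

section \<open>Monotonicity and chord bounds for convex profiles\<close>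

lemma slope_antimono:
  assumes "convex_profile n b" "i \<le> j"
  shows "slope n b j \<le> slope n b i"
proof -
  have "slope n b (Suc h) \<le> slope n b h" for h
    using assms(1) unfolding convex_profile_def curvature_def by (metis diff_ge_0_iff_ge)
  then show ?thesis
    using lift_Suc_antimono_le[of "slope n b", OF _ assms(2)] by blast
qed

lemma convex_profile_diff_le:
  assumes "convex_profile n b"
  shows "b l - b (l + w) \<le> int w * slope n b (Suc l)"
proof (induction w)
  case (Suc w)
  have "slope n b (Suc (l + w)) \<le> slope n b (Suc l)"
    by (rule slope_antimono[OF assms]) simp
  then show ?case
    using Suc by (simp add: algebra_simps)
qed simp

lemma convex_profile_diff_ge:
  assumes "convex_profile n b"
  shows "int w * slope n b (l + w) \<le> b l - b (l + w)"
proof (induction w)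
  case (Suc w)
  have "slope n b (Suc (l + w)) \<le> slope n b (l + w)"
    by (rule slope_antimono[OF assms]) simp
  then have "int w * slope n b (Suc (l + w)) \<le> b l - b (l + w)"
    using Suc by (meson mult_left_mono of_nat_0_le_iff order_trans)
  then show ?case
    by (simp add: algebra_simps)
qed simp

lemma convex_profile_antimono:
  assumes "convex_profile n b" "i \<le> j"
  shows "b j \<le> b i"
proof -
  have "b (Suc h) \<le> b h" for h
    using assms(1) slope_Suc[of n b h] unfolding convex_profile_def by (metis diff_ge_0_iff_ge)
  then show ?thesis
    using lift_Suc_antimono_le[of b, OF _ assms(2)] by blast
qed

section \<open>Potential arguments: spreading and transporting heat\<close>

text \<open>The curvatures in the window telescope to the drop of the slope, so one of them is at
  least \<open>s\<close>. Halving with rounding keeps at least a third of it, the worst integer from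
  2 on being 3.\<close>

lemma exists_large_gain:
  fixes s :: real
  assumes "2 \<le> s" "l < r"
    and sum: "s * real (r - l) \<le> real_of_int (slope n b l - slope n b r)"
  obtains h where "l \<le> h" "h < r" "s / 3 \<le> real_of_int (curvature n b h div 2)"
proof -
  have "\<exists>h\<in>{l..<r}. s \<le> real_of_int (curvature n b h)"
  proof (rule ccontr)
    assume "\<not> ?thesis"
    then have "(\<Sum>h\<in>{l..<r}. real_of_int (curvature n b h)) < (\<Sum>h\<in>{l..<r}. s)"
      using \<open>l < r\<close> by (intro sum_strict_mono) (auto simp: not_le)
    moreover have "(\<Sum>h\<in>{l..<r}. curvature n b h) = slope n b l - slope n b r"
      using \<open>l < r\<close> sum_Suc_diff'[of l r "\<lambda>h. - slope n b h"]
      by (simp add: curvature_def del: slope_Suc)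
    ultimately show False
      using sum by (simp add: mult.commute flip: of_int_sum)
  qed
  then obtain h where h: "l \<le> h" "h < r" "s \<le> real_of_int (curvature n b h)"
    by auto
  have "2 \<le> curvature n b h"
    using h(3) assms(1) by linarith
  then have "curvature n b h \<le> 3 * (curvature n b h div 2)"
    by presburger
  then have "real_of_int (curvature n b h) \<le> real_of_int (3 * (curvature n b h div 2))"
    by (simp only: of_int_le_iff)
  then show ?thesis
    using that h by simp
qed

text \<open>While \<open>Q\<close> fails, each step gains \<open>\<delta>\<close> below the ceiling
  \<open>W\<close>, so this cannot last. Each choice depends only on the profile so far, hence the
  choices form one fixed list; \<open>P\<close> is the invariant.\<close>

lemma reach_by_potential:
  fixes \<Phi> :: "'a \<Rightarrow> real" and f :: "'b \<Rightarrow> 'a \<Rightarrow> 'a"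
  assumes "P b" "0 \<le> \<Phi> b" "0 < \<delta>" "0 \<le> W"
    and step: "\<And>b. P b \<Longrightarrow> \<not> Q b \<Longrightarrow> \<exists>h. P (f h b) \<and> \<Phi> b + \<delta> \<le> \<Phi> (f h b)"
    and bound: "\<And>b. P b \<Longrightarrow> \<not> Q b \<Longrightarrow> \<Phi> b \<le> W"
  obtains hs where "real (length hs) \<le> W / \<delta> + 1" "P (fold f hs b)" "Q (fold f hs b)"
proof -
  \<comment> \<open>Induction on the step budget \<open>m\<close>: at \<open>m = 0\<close> the
    potential exceeds \<open>W\<close>, which forces \<open>Q\<close>.\<close>
  have *: "\<exists>hs. length hs \<le> m \<and> P (fold f hs b) \<and> Q (fold f hs b)"
    if "P b" "W < \<Phi> b + real m * \<delta>" for m b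
    using that
  proof (induction m arbitrary: b)
    case 0
    then show ?case
      using bound[of b] by (intro exI[of _ "[]"]) auto
  next
    case (Suc m)
    show ?case
    proof (cases "Q b")
      case True
      then show ?thesis
        using Suc.prems by (intro exI[of _ "[]"]) auto
    next
      case False
      then obtain h where h: "P (f h b)" "\<Phi> b + \<delta> \<le> \<Phi> (f h b)"
        using step Suc.prems by blast
      then have "W < \<Phi> (f h b) + real m * \<delta>"
        using Suc.prems by (simp add: algebra_simps)
      with Suc.IH h(1) obtain hs where "length hs \<le> m" "P (fold f hs (f h b))" "Q (fold f hs (f h b))"
        by blast
      then show ?thesis
        by (intro exI[of _ "h # hs"]) auto
    qed
  qed
  define m where "m = nat \<lfloor>W / \<delta>\<rfloor> + 1"
  have m: "real m \<le> W / \<delta> + 1" "W / \<delta> < real m"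
    using assms(3,4) by (auto simp: m_def) linarith+
  then have "W < \<Phi> b + real m * \<delta>"
    using assms(2,3) by (simp add: field_simps)
  from *[OF assms(1) this] m(1) that show ?thesis
    by (meson of_nat_mono order_trans)
qed

lemma sum_bump:
  assumes "l \<le> h" "h < r"
  shows "(\<Sum>j\<in>{l..<r}. real_of_int (bump n h b j))
    = (\<Sum>j\<in>{l..<r}. real_of_int (b j)) + real_of_int (curvature n b h div 2)"
proof -
  have "(\<Sum>j\<in>{l..<r}. real_of_int (bump n h b j))
      = (\<Sum>j\<in>{l..<r}. real_of_int (b j) + (if j = h then real_of_int (curvature n b h div 2) else 0))"
    by (intro sum.cong) (auto simp: bump_def)
  then show ?thesis
    using assms by (simp add: sum.distrib)
qed

text \<open>While \<open>b w\<close> is below \<open>n * w / 2\<close>, convexity puts the slope at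
  \<open>2 * w\<close> below \<open>n / 2\<close>, whereas the slope at 0 is \<open>n\<close>. The
  mean curvature of the window is then at least \<open>n / (4 * w)\<close>, which is at least 2 by
  assumption, and some update gains a third of that.\<close>

lemma initial_spread:
  assumes "convex_profile n b" "0 < w" "8 * w \<le> n"
  obtains hs where "length hs \<le> 37 * w ^ 3" "convex_profile n (fold (bump n) hs b)"
    "int n * int w \<le> 2 * fold (bump n) hs b w"
proof -
  define \<Phi> where "\<Phi> b = (\<Sum>j\<in>{0..<2 * w}. real_of_int (b j))" for b :: "nat \<Rightarrow> int"
  define \<delta> where "\<delta> = real n / (12 * real w)"
  define W where "W = 3 * real n * real w ^ 2"
  let ?Q = "\<lambda>b. int n * int w \<le> 2 * b w"
  have n: "8 * real w \<le> real n" "0 < real n"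
    using assms(2,3) by linarith+
  have "\<exists>h. convex_profile n (bump n h b) \<and> \<Phi> b + \<delta> \<le> \<Phi> (bump n h b)"
    if b: "convex_profile n b" and nQ: "\<not> ?Q b" for b
  proof -
    have "0 \<le> b (2 * w)"
      using b by (simp add: convex_profile_def)
    then have "int w * slope n b (2 * w) \<le> b w"
      using convex_profile_diff_ge[OF b, of w w] by (simp add: mult_2)
    then have "int w * (2 * slope n b (2 * w)) \<le> 2 * b w"
      by simp
    then have "int w * (2 * slope n b (2 * w)) < int w * int n"
      using nQ by (simp add: mult.commute)
    then have "2 * slope n b (2 * w) < int n"
      using assms(2) by simp
    then have "real_of_int (2 * slope n b (2 * w)) < real_of_int (int n)"
      by (simp only: of_int_less_iff)
    then have "real n / (4 * real w) * real (2 * w - 0) \<le> real_of_int (slope n b 0 - slope n b (2 * w))"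
      using assms(2) by (simp add: field_simps)
    moreover have "2 \<le> real n / (4 * real w)"
      using n assms(2) by (simp add: field_simps)
    ultimately obtain h where "h < 2 * w" "real n / (4 * real w) / 3 \<le> real_of_int (curvature n b h div 2)"
      using exists_large_gain[of "real n / (4 * real w)" 0 "2 * w"] assms(2)
      by (metis mult_pos_pos zero_less_numeral)
    then show ?thesis
      using convex_profile_bump[OF b, of h]
      by (intro exI[of _ h]) (auto simp: \<Phi>_def sum_bump \<delta>_def)
  qed
  moreover have "\<Phi> b \<le> W" if b: "convex_profile n b" and nQ: "\<not> ?Q b" for b
  proof -
    \<comment> \<open>Slopes are at most \<open>n\<close>, so \<open>b 0\<close> exceeds
      \<open>b w\<close> by at most \<open>n * w\<close>. Summing over the \<open>2 * w\<close>
      sites gives \<open>W\<close>.\<close>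
    have "2 * b j \<le> 3 * (int n * int w)" for j
    proof -
      have "b j \<le> b 0"
        using b by (rule convex_profile_antimono) simp
      moreover have "b 0 - b w \<le> int w * slope n b (Suc 0)"
        using convex_profile_diff_le[OF b, of 0 w] by simp
      moreover have "int w * slope n b (Suc 0) \<le> int w * int n"
        using slope_antimono[OF b, of 0 "Suc 0"] by (intro mult_left_mono) auto
      ultimately show ?thesis
        using nQ by (simp add: mult.commute)
    qed
    then have "real_of_int (2 * b j) \<le> real_of_int (3 * (int n * int w))" for j
      by (simp only: of_int_le_iff)
    then have "(\<Sum>j\<in>{0..<2 * w}. real_of_int (b j)) \<le> (\<Sum>j\<in>{0..<2 * w}. 3 * (real n * real w) / 2)"
      by (intro sum_mono) (simp add: field_simps)
    then show ?thesis
      by (simp add: \<Phi>_def W_def power2_eq_square)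
  qed
  moreover have "0 \<le> \<Phi> b"
    using assms(1) by (auto simp: \<Phi>_def convex_profile_def intro!: sum_nonneg)
  moreover have "0 < \<delta>" "0 \<le> W"
    using n assms(2) by (auto simp: \<delta>_def W_def)
  ultimately obtain hs where hs: "real (length hs) \<le> W / \<delta> + 1"
      "convex_profile n (fold (bump n) hs b)" "?Q (fold (bump n) hs b)"
    using reach_by_potential[where P = "convex_profile n" and Q = ?Q and f = "bump n"] assms(1)
    by metis
  \<comment> \<open>The additional step of the potential argument is absorbed in the cube, turning
    36 into 37.\<close>
  have w_cube: "1 \<le> real w ^ 3"
    using assms(2) by (intro one_le_power) simp
  have "W / \<delta> = 36 * real w ^ 3"
    using n assms(2) by (simp add: W_def \<delta>_def field_simps power2_eq_square power3_eq_cube)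
  then have "real (length hs) \<le> real (37 * w ^ 3)"
    using hs(1) w_cube by simp
  then show ?thesis
    using that hs by (metis of_nat_le_iff)
qed

text \<open>Only sites right of \<open>l\<close> are updated, so \<open>l\<close> acts as a source
  of constant value \<open>N\<close>. While \<open>b (l + w)\<close> is below \<open>N / 4\<close>,
  the slope exceeds \<open>3 * N / (4 * w)\<close> at \<open>Suc l\<close> and is below
  \<open>N / (4 * w)\<close> at \<open>l + 2 * w\<close>; this drop gives mean curvature at least
  \<open>N / (4 * w ^ 2)\<close>, again at least 2 by assumption.\<close>

lemma transport:
  assumes "convex_profile n b" "0 < w" "8 * int w ^ 2 \<le> b l"
  obtains hs where "length hs \<le> 37 * w ^ 3" "convex_profile n (fold (bump n) hs b)"
    "b l \<le> 4 * fold (bump n) hs b (l + w)"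
proof -
  define \<Phi> where "\<Phi> b = (\<Sum>j\<in>{Suc l..<Suc (l + 2 * w)}. real_of_int (b j))" for b :: "nat \<Rightarrow> int"
  define N where "N = b l"
  define \<delta> where "\<delta> = real_of_int N / (12 * real w ^ 2)"
  define W where "W = 2 * real w * real_of_int N"
  let ?P = "\<lambda>b. convex_profile n b \<and> b l = N"
  let ?Q = "\<lambda>b. N \<le> 4 * b (l + w)"
  have "real_of_int (8 * int w ^ 2) \<le> real_of_int N"
    using assms(3) unfolding N_def by (simp only: of_int_le_iff)
  then have N: "8 * real w ^ 2 \<le> real_of_int N"
    by simp
  moreover have "0 < 8 * real w ^ 2"
    using assms(2) by simp
  ultimately have N_pos: "0 < real_of_int N"
    by (rule less_le_trans[rotated])
  have step: "\<exists>h. ?P (bump n h b) \<and> \<Phi> b + \<delta> \<le> \<Phi> (bump n h b)"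
    if P: "?P b" and nQ: "\<not> ?Q b" for b
  proof -
    have b: "convex_profile n b"
      using P by simp
    have "0 \<le> b (l + w + w)"
      using b by (simp add: convex_profile_def)
    then have "int w * slope n b (l + w + w) \<le> b (l + w)"
      using convex_profile_diff_ge[OF b, of w "l + w"] by simp
    moreover have "int w * slope n b (Suc (l + w + w)) \<le> int w * slope n b (l + w + w)"
      using slope_antimono[OF b] by (intro mult_left_mono) (simp_all del: slope_Suc)
    moreover have "N - b (l + w) \<le> int w * slope n b (Suc l)"
      using convex_profile_diff_le[OF b, of l w] P by simp
    ultimately have "N \<le> 2 * (int w * slope n b (Suc l) - int w * slope n b (Suc (l + w + w)))"
      using nQ by (smt (verit))
    moreover have "l + w + w = l + 2 * w"
      by simp
    ultimately have "N \<le> 2 * (int w * slope n b (Suc l) - int w * slope n b (Suc (l + 2 * w)))"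
      by (simp only:)
    then have "N \<le> 2 * (int w * (slope n b (Suc l) - slope n b (Suc (l + 2 * w))))"
      by (simp only: right_diff_distrib)
    then have "real_of_int N \<le> real_of_int (2 * (int w * (slope n b (Suc l) - slope n b (Suc (l + 2 * w)))))"
      by (simp only: of_int_le_iff)
    then have "real_of_int N \<le> 2 * (real w * real_of_int (slope n b (Suc l) - slope n b (Suc (l + 2 * w))))"
      by (simp only: of_int_mult of_int_numeral of_int_of_nat_eq)
    then have "real_of_int N / (4 * real w ^ 2) * real (Suc (l + 2 * w) - Suc l)
        \<le> real_of_int (slope n b (Suc l) - slope n b (Suc (l + 2 * w)))"
      using assms(2) by (simp add: field_simps power2_eq_square del: slope_Suc of_int_diff)
    moreover have "2 \<le> real_of_int N / (4 * real w ^ 2)"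
      using N assms(2) by (simp add: field_simps)
    ultimately obtain h where "Suc l \<le> h" "h < Suc (l + 2 * w)"
        "real_of_int N / (4 * real w ^ 2) / 3 \<le> real_of_int (curvature n b h div 2)"
      using exists_large_gain[of "real_of_int N / (4 * real w ^ 2)" "Suc l" "Suc (l + 2 * w)" n b] assms(2)
      by auto
    moreover from this have "bump n h b l = b l"
      by (simp add: bump_def)
    ultimately show ?thesis
      using convex_profile_bump[OF b, of h] P
      by (intro exI[of _ h]) (auto simp: \<Phi>_def sum_bump \<delta>_def simp del: sum.op_ivl_Suc)
  qed
  have bound: "\<Phi> b \<le> W" if "?P b" "\<not> ?Q b" for b
  proof -
    have "\<Phi> b \<le> (\<Sum>j\<in>{Suc l..<Suc (l + 2 * w)}. real_of_int N)"
      unfolding \<Phi>_def using that(1) convex_profile_antimono[of n b l]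
      by (intro sum_mono) auto
    then show ?thesis
      by (simp add: W_def del: sum.op_ivl_Suc)
  qed
  have start: "?P b" "0 \<le> \<Phi> b"
    using assms(1) by (auto simp: \<Phi>_def N_def convex_profile_def simp del: sum.op_ivl_Suc intro!: sum_nonneg)
  have const_bounds: "0 < \<delta>" "0 \<le> W"
    using N_pos assms(2) by (auto simp: \<delta>_def W_def)
  obtain hs where hs: "real (length hs) \<le> W / \<delta> + 1"
      "?P (fold (bump n) hs b)" "?Q (fold (bump n) hs b)"
    using reach_by_potential[where P = ?P and Q = ?Q and f = "bump n", OF start const_bounds step bound]
    by blast
  have w_cube: "1 \<le> real w ^ 3"
    using assms(2) by (intro one_le_power) simp
  have "W / \<delta> = 24 * real w ^ 3"
    using N_pos assms(2) by (simp add: W_def \<delta>_def field_simps power2_eq_square power3_eq_cube)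
  \<comment> \<open>Here \<open>24 + 1\<close> would do; 37 matches the bound of the initial
    phase.\<close>
  then have "real (length hs) \<le> real (37 * w ^ 3)"
    using hs(1) w_cube by simp
  then show ?thesis
    using that hs unfolding N_def by (metis of_nat_le_iff)
qed

text \<open>One initial spread is followed by \<open>r\<close> transports, each of which moves
  \<open>w\<close> sites further and costs a factor 4.\<close>

lemma iterated_transport:
  assumes "0 < w" "8 * 4 ^ r * w \<le> n"
  shows "\<exists>hs. length hs \<le> 37 * w ^ 3 * (r + 1) \<and> convex_profile n (fold (bump n) hs (\<lambda>_. 0))
    \<and> int n * int w \<le> 2 * 4 ^ r * fold (bump n) hs (\<lambda>_. 0) ((r + 1) * w)"
  using assms(2)
proof (induction r)
  case 0
  have "convex_profile n (\<lambda>_. 0)"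
    by (auto simp: convex_profile_def curvature_def slope_def split: nat.split)
  from initial_spread[OF this assms(1)] 0 show ?case
    by auto
next
  case (Suc r)
  have n: "32 * (4 ^ r * w) \<le> n"
    using Suc.prems by simp
  then have "8 * 4 ^ r * w \<le> n"
    by simp
  from Suc.IH[OF this] obtain hs where hs: "length hs \<le> 37 * w ^ 3 * (r + 1)"
    "convex_profile n (fold (bump n) hs (\<lambda>_. 0))"
    "int n * int w \<le> 2 * 4 ^ r * fold (bump n) hs (\<lambda>_. 0) ((r + 1) * w)"
    by auto
  let ?b = "fold (bump n) hs (\<lambda>_. 0)" and ?l = "(r + 1) * w"
  \<comment> \<open>The size of \<open>n\<close> leaves the current source at least
    \<open>16 * w ^ 2\<close>, twice what the next transport requires.\<close>
  have "int (32 * (4 ^ r * w)) * int w \<le> int n * int w"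
    using n by (intro mult_right_mono) (simp_all only: of_nat_le_iff of_nat_0_le_iff)
  also note hs(3)
  finally have "2 * 4 ^ r * (16 * int w ^ 2) \<le> 2 * 4 ^ r * ?b ?l"
    by (simp add: power2_eq_square algebra_simps)
  then have "16 * int w ^ 2 \<le> ?b ?l"
    by simp
  then have "8 * int w ^ 2 \<le> ?b ?l"
    using zero_le_power2[of "int w"] by linarith
  from transport[OF hs(2) assms(1) this] obtain hs' where hs':
    "length hs' \<le> 37 * w ^ 3" "convex_profile n (fold (bump n) hs' ?b)"
    "?b ?l \<le> 4 * fold (bump n) hs' ?b (?l + w)"
    by blast
  have "int n * int w \<le> 2 * 4 ^ r * (4 * fold (bump n) hs' ?b (?l + w))"
    using hs(3) hs'(3) by (smt (verit) mult_left_mono zero_le_power)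
  then show ?case
    using hs(1) hs'(1,2)
    by (intro exI[of _ "hs @ hs'"]) (auto simp: algebra_simps)
qed

section \<open>The filler's moves\<close>

text \<open>The floor is exact on half-integral states and makes the excess an integer, comparable
  with the integer heat flow.\<close>

definition excess :: "nat \<Rightarrow> state \<Rightarrow> nat \<Rightarrow> int" where
  "excess n x j = (\<Sum>i<n. max 0 (\<lfloor>2 * x i\<rfloor> - int j))"

definition half_integral :: "nat \<Rightarrow> state \<Rightarrow> bool" where
  "half_integral n x \<longleftrightarrow> (\<forall>i<n. 0 \<le> x i \<and> 2 * x i \<in> \<int>)"

definition above :: "nat \<Rightarrow> nat \<Rightarrow> state \<Rightarrow> nat set" where
  "above n h x = {i. i < n \<and> real h < 2 * x i}"

definition at_level :: "nat \<Rightarrow> nat \<Rightarrow> state \<Rightarrow> nat set" where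
  "at_level n h x = {i. i < n \<and> 2 * x i = real h}"

text \<open>An arbitrary choice that drops at most one cup; even size makes the poured halves add up
  to an integer.\<close>

definition even_part :: "nat set \<Rightarrow> nat set" where
  "even_part U = (SOME B. B \<subseteq> U \<and> card B = 2 * (card U div 2))"

text \<open>A move needs at least one processor; pouring 1 into every cup is the neutral move.\<close>

definition level_move :: "nat \<Rightarrow> nat \<Rightarrow> state \<Rightarrow> fmove" where
  "level_move n h x =
    (let G = above n h x; U = at_level n h x; p = card G + card U div 2
     in if p = 0 then (n, \<lambda>_. 1)
        else (p, \<lambda>i. if i \<in> G then 1 else if i \<in> even_part U then 1 / 2 else 0))"

lemma even_part: "even_part U \<subseteq> U" "card (even_part U) = 2 * (card U div 2)"
proof -
  have "2 * (card U div 2) \<le> card U"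
    by simp
  then obtain B where "B \<subseteq> U" "card B = 2 * (card U div 2)"
    by (meson obtain_subset_with_card_n)
  then have "even_part U \<subseteq> U \<and> card (even_part U) = 2 * (card U div 2)"
    unfolding even_part_def by (metis (mono_tags, lifting) someI_ex)
  then show "even_part U \<subseteq> U" "card (even_part U) = 2 * (card U div 2)"
    by auto
qed

section \<open>Effect of one round on the excesses\<close>

lemma sum_indicator_subset:
  fixes c :: "'a :: comm_semiring_1"
  assumes "A \<subseteq> {..<n::nat}"
  shows "(\<Sum>i<n. if i \<in> A then c else 0) = of_nat (card A) * c"
  using assms by (simp add: sum.If_cases Int_absorb1)

lemma valid_level_move:
  assumes "0 < n"
  shows "valid_fill n (level_move n h x)"
proof -
  define G U B where "G = above n h x" and "U = at_level n h x" and "B = even_part U"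
  define p where "p = card G + card U div 2"
  have GU: "G \<subseteq> {..<n}" "U \<subseteq> {..<n}" "G \<inter> U = {}"
    by (auto simp: G_def U_def above_def at_level_def)
  have B: "B \<subseteq> U" "card B = 2 * (card U div 2)"
    using even_part by (auto simp: B_def)
  have "card G + card U = card (G \<union> U)"
    using GU by (metis card_Un_disjoint finite_lessThan finite_subset)
  also have "\<dots> \<le> n"
    using GU card_mono[of "{..<n}" "G \<union> U"] by simp
  finally have "p \<le> n"
    by (simp add: p_def)
  have "(\<Sum>i<n. if i \<in> G then 1 else if i \<in> B then 1 / 2 else 0 :: real)
      = (\<Sum>i<n. (if i \<in> G then 1 else 0) + (if i \<in> B then 1 / 2 else 0))"
    using GU(3) B(1) by (intro sum.cong) auto
  also have "\<dots> = real p"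
    using GU B by (simp add: sum.distrib sum_indicator_subset p_def)
  finally show ?thesis
    using assms \<open>p \<le> n\<close>
    unfolding level_move_def Let_def G_def[symmetric] U_def[symmetric] B_def[symmetric] p_def[symmetric]
    by (auto simp: valid_fill_def)
qed

text \<open>Fills are doubled: \<open>G\<close> gains 2, \<open>B\<close> gains 1, emptying costs at
  most 2. Below level \<open>h\<close>, the poured \<open>2 * card G + 2 * q\<close> balances the
  possible loss \<open>2 * card S\<close>. Above \<open>h\<close>, only cups of \<open>G\<close>
  have positive excess, and their gain covers any emptying.\<close>

lemma excess_growth:
  fixes X X' :: "nat \<Rightarrow> int" and h j :: int
  assumes G: "G = {i. i < n \<and> h < X i}" and B: "B \<subseteq> {i. i < n \<and> X i = h}" "card B = 2 * q"
    and S: "S \<subseteq> {..<n}" "card S = card G + q"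
    and X': "\<And>i. i < n \<Longrightarrow>
      X i + (if i \<in> G then 2 else if i \<in> B then 1 else 0) - (if i \<in> S then 2 else 0) \<le> X' i"
  shows "(\<Sum>i<n. max 0 (X i - j)) + (if j = h then int q else 0) \<le> (\<Sum>i<n. max 0 (X' i - j))"
proof -
  have sub: "G \<subseteq> {..<n}" "B \<subseteq> {..<n}"
    using G B by auto
  consider "j < h" | "j = h" | "h < j"
    by linarith
  then show ?thesis
  proof cases
    case 1
    have "(\<Sum>i<n. max 0 (X i - j) + (if i \<in> G then 2 else 0) + (if i \<in> B then 1 else 0) + (if i \<in> S then - 2 else 0))
        \<le> (\<Sum>i<n. max 0 (X' i - j))"
    proof (rule sum_mono)
      fix i assume "i \<in> {..<n}"
      then show "max 0 (X i - j) + (if i \<in> G then 2 else 0) + (if i \<in> B then 1 else 0) + (if i \<in> S then - 2 else 0)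
          \<le> max 0 (X' i - j)"
        using X'[of i] 1 G B by (auto split: if_splits)
    qed
    then show ?thesis
      using 1 sub S B(2) by (simp add: sum.distrib sum_indicator_subset)
  next
    case 2
    \<comment> \<open>At level \<open>h\<close>, crediting each cup of \<open>G\<close> and
      \<open>B\<close> with 1 suffices, as emptying a cup cancels at most its credit. There are
      \<open>card G + 2 * q\<close> credits and \<open>card G + q\<close> emptied cups, which leaves
      \<open>q\<close>.\<close>
    have "(\<Sum>i<n. max 0 (X i - j) + (if i \<in> G then 1 else 0) + (if i \<in> B then 1 else 0) + (if i \<in> S then - 1 else 0))
        \<le> (\<Sum>i<n. max 0 (X' i - j))"
    proof (rule sum_mono)
      fix i assume "i \<in> {..<n}"
      then show "max 0 (X i - j) + (if i \<in> G then 1 else 0) + (if i \<in> B then 1 else 0) + (if i \<in> S then - 1 else 0)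
          \<le> max 0 (X' i - j)"
        using X'[of i] 2 G B by (auto split: if_splits)
    qed
    then show ?thesis
      using 2 sub S B(2) by (simp add: sum.distrib sum_indicator_subset)
  next
    case 3
    have "max 0 (X i - j) \<le> max 0 (X' i - j)" if "i < n" for i
      using X'[of i] that 3 G by (auto split: if_splits)
    then show ?thesis
      using 3 by (auto intro: sum_mono)
  qed
qed

text \<open>Raising the threshold by one costs exactly 1 per cup that reaches the higher threshold.
  At level 0 all cups count, which explains the boundary value of \<open>slope\<close>.\<close>

lemma slope_excess:
  assumes "half_integral n x"
  shows "slope n (excess n x) h = int (card {i. i < n \<and> real h \<le> 2 * x i})"
proof (cases h)
  case 0
  have "{i. i < n \<and> 0 \<le> 2 * x i} = {..<n}"
    using assms by (auto simp: half_integral_def)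
  then show ?thesis
    using 0 by simp
next
  case (Suc j)
  have "slope n (excess n x) h
      = (\<Sum>i<n. max 0 (\<lfloor>2 * x i\<rfloor> - int j) - max 0 (\<lfloor>2 * x i\<rfloor> - int (Suc j)))"
    by (simp add: Suc excess_def sum_subtractf)
  also have "\<dots> = (\<Sum>i<n. if i \<in> {i. i < n \<and> real h \<le> 2 * x i} then 1 else 0)"
    by (intro sum.cong refl) (auto simp: Suc max_def le_floor_iff floor_less_iff floor_eq_iff)
  also have "\<dots> = int (card {i. i < n \<and> real h \<le> 2 * x i})"
    by (subst sum_indicator_subset) auto
  finally show ?thesis .
qed

lemma curvature_excess:
  assumes "half_integral n x"
  shows "curvature n (excess n x) h = int (card (at_level n h x))"
proof -
  have "{i. i < n \<and> real h \<le> 2 * x i} = {i. i < n \<and> real (Suc h) \<le> 2 * x i} \<union> at_level n h x"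
  proof -
    have "real (Suc h) \<le> 2 * x i" if "i < n" "real h \<le> 2 * x i" "2 * x i \<noteq> real h" for i
    proof -
      obtain z where "2 * x i = real_of_int z"
        using assms \<open>i < n\<close> by (auto simp: half_integral_def elim: Ints_cases)
      moreover from this that have "int h < z"
        by linarith
      ultimately show ?thesis
        by linarith
    qed
    then show ?thesis
      by (auto simp: at_level_def)
  qed
  moreover have "{i. i < n \<and> real (Suc h) \<le> 2 * x i} \<inter> at_level n h x = {}"
    by (auto simp: at_level_def)
  ultimately have "card {i. i < n \<and> real h \<le> 2 * x i}
      = card {i. i < n \<and> real (Suc h) \<le> 2 * x i} + card (at_level n h x)"
    by (simp add: card_Un_disjoint at_level_def)
  then show ?thesis
    unfolding curvature_def slope_excess[OF assms] by simp
qed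

text \<open>By \<open>curvature_excess\<close>, \<open>bump\<close> adds half the number of cups at
  level \<open>h\<close>, rounded down, which is the growth that \<open>excess_growth\<close>
  guarantees.\<close>

lemma level_move_step:
  assumes "0 < n" "half_integral n x"
    and S: "valid_empty n (fst (level_move n h x)) S"
    and x': "x' = empty_step (fill_step x (snd (level_move n h x))) S"
  shows "half_integral n x'" "bump n h (excess n x) j \<le> excess n x' j"
proof -
  let ?a = "snd (level_move n h x)"
  have a: "0 \<le> ?a i" "2 * ?a i \<in> \<int>" for i
    by (auto simp: level_move_def Let_def)
  show *: "half_integral n x'"
    unfolding half_integral_def
  proof (intro allI impI conjI)
    fix i assume "i < n"
    with assms(2) have x: "0 \<le> x i" "2 * x i \<in> \<int>"
      by (auto simp: half_integral_def)
    then show "0 \<le> x' i"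
      using a(1)[of i] by (simp add: x' empty_step_def fill_step_def)
    have "2 * x i + 2 * ?a i \<in> \<int>" "2 * x i + 2 * ?a i - 2 \<in> \<int>"
      using x a(2)[of i] by auto
    then show "2 * x' i \<in> \<int>"
      by (auto simp: x' empty_step_def fill_step_def max_def algebra_simps)
  qed
  define G U B where "G = above n h x" and "U = at_level n h x" and "B = even_part U"
  have gain: "bump n h (excess n x) j = excess n x j + (if j = h then int (card U div 2) else 0)"
    by (simp add: bump_def curvature_excess[OF assms(2)] U_def zdiv_int)
  have x'_ge: "x i + ?a i - (if i \<in> S then 1 else 0) \<le> x' i" for i
    by (auto simp: x' empty_step_def fill_step_def)
  have X: "2 * x i = real_of_int \<lfloor>2 * x i\<rfloor>" "2 * x' i = real_of_int \<lfloor>2 * x' i\<rfloor>" if "i < n" for i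
    using * assms(2) that by (auto simp: half_integral_def elim!: Ints_cases)
  show "bump n h (excess n x) j \<le> excess n x' j"
  proof (cases "card G + card U div 2 = 0")
    \<comment> \<open>At most one cup is at the level, so no gain is due; pouring 1 everywhere makes
      up for any emptying.\<close>
    case True
    then have "?a = (\<lambda>_. 1)"
      by (simp add: level_move_def Let_def G_def U_def)
    then have "x i \<le> x' i" for i
      using x'_ge[of i] by (auto split: if_splits)
    then have "excess n x j \<le> excess n x' j"
      unfolding excess_def by (intro sum_mono max.mono diff_mono floor_mono) auto
    then show ?thesis
      unfolding gain using True by auto
  next
    case False
    then have move: "level_move n h x = (card G + card U div 2, \<lambda>i. if i \<in> G then 1 else if i \<in> B then 1 / 2 else 0)"
      by (auto simp: level_move_def Let_def G_def U_def B_def)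
    have B: "B \<subseteq> U" "card B = 2 * (card U div 2)"
      using even_part by (auto simp: B_def)
    have "excess n x j + (if int j = int h then int (card U div 2) else 0) \<le> excess n x' j"
      unfolding excess_def
    proof (rule excess_growth)
      show "G = {i. i < n \<and> int h < \<lfloor>2 * x i\<rfloor>}"
        using X(1) by (auto simp: G_def above_def) (metis of_int_less_iff of_int_of_nat_eq)+
      show "B \<subseteq> {i. i < n \<and> \<lfloor>2 * x i\<rfloor> = int h}"
        using B(1) by (auto simp: U_def at_level_def)
      show "card B = 2 * (card U div 2)"
        by (rule B(2))
      show "S \<subseteq> {..<n}" "card S = card G + card U div 2"
        using S by (auto simp: move valid_empty_def)
      fix i assume "i < n"
      have "2 * x i + (if i \<in> G then 2 else if i \<in> B then 1 else 0) - (if i \<in> S then 2 else 0) \<le> 2 * x' i"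
        using x'_ge[of i] by (auto simp: move split: if_splits)
      then have "real_of_int (\<lfloor>2 * x i\<rfloor> + (if i \<in> G then 2 else if i \<in> B then 1 else 0) - (if i \<in> S then 2 else 0))
          \<le> real_of_int \<lfloor>2 * x' i\<rfloor>"
        using X[OF \<open>i < n\<close>] by (auto split: if_splits)
      then show "\<lfloor>2 * x i\<rfloor> + (if i \<in> G then 2 else if i \<in> B then 1 else 0) - (if i \<in> S then 2 else 0)
          \<le> \<lfloor>2 * x' i\<rfloor>"
        by (simp only: of_int_le_iff)
    qed
    then show ?thesis
      by (simp add: gain)
  qed
qed

text \<open>Levels are fixed in advance, cups are chosen from the current state. After
  \<open>t\<close> rounds the history has length \<open>t + 1\<close>; level 0 is a default once the
  schedule is exhausted.\<close>

definition schedule_strategy :: "nat \<Rightarrow> nat list \<Rightarrow> filler_strategy" where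
  "schedule_strategy n hs H =
    level_move n (if length H - 1 < length hs then hs ! (length H - 1) else 0) (hd H)"

lemma length_play: "length (play F E t) = Suc t"
  by (induction t) (simp_all add: Let_def)

text \<open>Each round dominates a bump of the actual excesses, and by \<open>bump_mono\<close> that
  dominates the bump of the flow, whatever the emptier did before.\<close>

lemma play_schedule:
  assumes "0 < n" "emptier_ok n E" "t \<le> length hs"
  shows "half_integral n (hd (play (schedule_strategy n hs) E t)) \<and>
    (\<forall>j. fold (bump n) (take t hs) (\<lambda>_. 0) j \<le> excess n (hd (play (schedule_strategy n hs) E t)) j)"
  using assms(3)
proof (induction t)
  case 0
  show ?case
    by (auto simp: half_integral_def excess_def intro!: sum_nonneg)
next
  case (Suc t)
  let ?F = "schedule_strategy n hs"
  let ?H = "play ?F E t"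
  let ?x = "hd ?H" and ?x' = "hd (play ?F E (Suc t))" and ?S = "E ?H (?F ?H)"
  have F: "?F ?H = level_move n (hs ! t) ?x"
    using Suc.prems by (simp add: schedule_strategy_def length_play)
  have IH: "half_integral n ?x" "\<And>j. fold (bump n) (take t hs) (\<lambda>_. 0) j \<le> excess n ?x j"
    using Suc by auto
  have "valid_empty n (fst (level_move n (hs ! t) ?x)) ?S"
    using assms(2) valid_level_move[OF assms(1)] unfolding emptier_ok_def F by blast
  moreover have "?x' = empty_step (fill_step ?x (snd (level_move n (hs ! t) ?x))) ?S"
    by (simp add: Let_def F)
  ultimately have step: "half_integral n ?x'" "\<And>j. bump n (hs ! t) (excess n ?x) j \<le> excess n ?x' j"
    using level_move_step[OF assms(1) IH(1)] by blast+
  have "fold (bump n) (take (Suc t) hs) (\<lambda>_. 0) = bump n (hs ! t) (fold (bump n) (take t hs) (\<lambda>_. 0))"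
    using Suc.prems by (simp add: take_Suc_conv_app_nth)
  then have "fold (bump n) (take (Suc t) hs) (\<lambda>_. 0) j \<le> excess n ?x' j" for j
    using order_trans[OF bump_mono[OF IH(2)] step(2)] by (simp del: play.simps)
  then show ?case
    using step(1) by blast
qed

lemma backlog_ge_if_excess_pos:
  assumes "0 < excess n x j"
  shows "real j / 2 \<le> backlog n x"
proof -
  obtain i where i: "i < n" "0 < max 0 (\<lfloor>2 * x i\<rfloor> - int j)"
    using assms sum_nonpos[of "{..<n}" "\<lambda>i. max 0 (\<lfloor>2 * x i\<rfloor> - int j)"]
    unfolding excess_def by (meson lessThan_iff not_le)
  then have "real j \<le> 2 * x i"
    by (simp add: max_def split: if_splits) linarith
  moreover have "x i \<le> backlog n x"
    using i(1) by (auto simp: backlog_def)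
  ultimately show ?thesis
    by simp
qed

section \<open>The time bound\<close>

lemma filler_reaches:
  assumes "0 < w" "8 * 4 ^ r * w \<le> n"
  shows "\<exists>F. filler_ok n F \<and> (\<forall>E. emptier_ok n E \<longrightarrow>
    (\<exists>t \<le> 37 * w ^ 3 * (r + 1). real ((r + 1) * w) / 2 \<le> backlog n (hd (play F E t))))"
proof -
  from iterated_transport[OF assms] obtain hs where hs: "length hs \<le> 37 * w ^ 3 * (r + 1)"
    "int n * int w \<le> 2 * 4 ^ r * fold (bump n) hs (\<lambda>_. 0) ((r + 1) * w)"
    by blast
  have "0 < 8 * 4 ^ r * w"
    using assms(1) by simp
  with assms(2) have n: "0 < n"
    by linarith
  have "0 < int n * int w"
    using n assms(1) by simp
  with hs(2) have "0 < 2 * 4 ^ r * fold (bump n) hs (\<lambda>_. 0) ((r + 1) * w)"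
    by linarith
  then have pos: "0 < fold (bump n) hs (\<lambda>_. 0) ((r + 1) * w)"
    by (simp add: zero_less_mult_iff)
  have "real ((r + 1) * w) / 2 \<le> backlog n (hd (play (schedule_strategy n hs) E (length hs)))"
    if "emptier_ok n E" for E
    using play_schedule[OF n that order_refl, of hs] pos
    by (intro backlog_ge_if_excess_pos) (metis less_le_trans take_all order_refl)
  moreover have "filler_ok n (schedule_strategy n hs)"
    using n by (auto simp: filler_ok_def schedule_strategy_def valid_level_move)
  ultimately show ?thesis
    using hs(1) by blast
qed

text \<open>About \<open>ln (n / k)\<close> transports of width about \<open>k / r\<close> balance
  the factor \<open>4 ^ r\<close> lost against the available \<open>n / k\<close>.\<close>

lemma exists_window:
  fixes n k :: nat
  assumes "0 < k" "real k \<le> exp (- 16) * real n"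
  obtains w r where "0 < w" "8 * 4 ^ r * w \<le> n" "k \<le> (r + 1) * w"
    "real (37 * w ^ 3 * (r + 1)) \<le> 40000 * (real k + real k ^ 3 / (ln (real n / real k))\<^sup>2)"
proof -
  define l where "l = ln (real n / real k)"
  \<comment> \<open>The cap at \<open>k\<close> keeps the rounded-up quotient \<open>w\<close> of
    \<open>k\<close> by \<open>r\<close> within \<open>2 * k / r\<close>; the quarter yields
    \<open>4 ^ r \<le> exp (l / 2)\<close>, the square root of \<open>n / k\<close>.\<close>
  define r where "r = min k (nat \<lfloor>l / 4\<rfloor>)"
  define w where "w = (k + r - 1) div r"
  have n: "0 < real n"
    using assms by (smt (verit) exp_gt_zero of_nat_0_less_iff zero_less_mult_iff)
  have "exp 16 \<le> real n / real k"
    using assms by (simp add: field_simps exp_minus)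
  then have l: "16 \<le> l"
    using n assms(1) by (simp add: l_def ln_ge_iff)
  have el: "exp l = real n / real k"
    using n assms(1) by (simp add: l_def)
  have "4 \<le> nat \<lfloor>l / 4\<rfloor>"
    using l by (simp add: le_nat_floor le_floor_iff)
  then have r: "1 \<le> r" "r \<le> k"
    using assms(1) by (auto simp: r_def)
  have "real r \<le> real (nat \<lfloor>l / 4\<rfloor>)"
    by (simp add: r_def)
  then have rl: "4 * real r \<le> l"
    using l by linarith
  have "r * w + (k + r - 1) mod r = k + r - 1" "(k + r - 1) mod r < r"
    using r by (auto simp: w_def)
  then have rw: "k \<le> r * w" "r * w < k + r"
    using r by linarith+
  have w: "0 < w"
    using rw(1) assms(1) by (cases w) auto
  have "r * w < 2 * k"
    using rw(2) r(2) by simp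
  then have wr: "real r * real w \<le> 2 * real k"
    by (metis less_imp_le of_nat_le_iff of_nat_mult of_nat_numeral)
  have "k + r - 1 \<le> k * r"
  proof -
    obtain k' r' where "k = Suc k'" "r = Suc r'"
      using r assms(1) by (metis Suc_pred' less_le_trans zero_less_one)
    then show ?thesis
      by simp
  qed
  then have wk: "w \<le> k"
    using r(1) div_le_mono[of "k + r - 1" "k * r" r] by (simp add: w_def)

  have "(2::real) \<le> exp 1"
    using exp_ge_add_one_self[of 1] by simp
  then have "(4::real) \<le> exp 2"
    using power_mono[of 2 "exp (1::real)" 2] by (simp flip: exp_of_nat_mult)
  then have "(4::real) ^ r \<le> exp 2 ^ r"
    by (intro power_mono) auto
  also have "\<dots> = exp (2 * real r)"
    by (simp add: mult.commute flip: exp_of_nat_mult)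
  also have "\<dots> \<le> exp (l / 2)"
    using rl by simp
  finally have "4 ^ r \<le> exp (l / 2)" .
  \<comment> \<open>The other square root of \<open>n / k\<close> absorbs the factor 8, since
    \<open>l\<close> is at least 16.\<close>
  moreover have "8 \<le> exp (l / 2)"
    using l exp_ge_add_one_self[of "l / 2"] by linarith
  ultimately have "8 * 4 ^ r \<le> exp (l / 2) * exp (l / 2)"
    by (intro mult_mono) auto
  then have "8 * 4 ^ r \<le> real n / real k"
    by (simp add: el flip: exp_add)
  then have "8 * 4 ^ r * real k \<le> real n"
    using assms(1) by (simp add: field_simps)
  moreover have "8 * 4 ^ r * real w \<le> 8 * 4 ^ r * real k"
    using wk by simp
  ultimately have "8 * 4 ^ r * real w \<le> real n"
    by (rule order_trans[rotated])
  then have "real (8 * 4 ^ r * w) \<le> real n"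
    by simp
  then have nw: "8 * 4 ^ r * w \<le> n"
    by (simp only: of_nat_le_iff)

  have "(real r * real w) ^ 3 \<le> (2 * real k) ^ 3"
    using wr by (intro power_mono) auto
  then have cube: "real r ^ 3 * real w ^ 3 \<le> 8 * real k ^ 3"
    by (simp add: power_mult_distrib)
  have "real (37 * w ^ 3 * (r + 1)) \<le> 74 * (real w ^ 3 * real r)"
  proof -
    have "real w ^ 3 * (real r + 1) \<le> real w ^ 3 * (2 * real r)"
      using r(1) by (intro mult_left_mono) auto
    then show ?thesis
      by (simp add: algebra_simps)
  qed
  also have "real w ^ 3 * real r \<le> 8 * real k ^ 3 / real r ^ 2"
    using cube r(1) by (simp add: field_simps power2_eq_square power3_eq_cube)
  finally have time: "real (37 * w ^ 3 * (r + 1)) \<le> 592 * (real k ^ 3 / real r ^ 2)"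
    by simp
  \<comment> \<open>If the cap is attained, the cost is linear in \<open>k\<close>. Otherwise
    \<open>r\<close> is at least \<open>l / 8\<close>, which gives the cubic term with constant
    \<open>592 * 64 = 37888\<close>.\<close>
  have "592 * (real k ^ 3 / real r ^ 2) \<le> 40000 * (real k + real k ^ 3 / l\<^sup>2)"
  proof (cases "r = k")
    case True
    then have "real k ^ 3 / real r ^ 2 = real k"
      using assms(1) by (simp add: power2_eq_square power3_eq_cube)
    moreover have "0 \<le> real k ^ 3 / l\<^sup>2"
      by simp
    ultimately show ?thesis
      by (simp add: distrib_left)
  next
    case False
    then have "r = nat \<lfloor>l / 4\<rfloor>"
      by (auto simp: r_def min_def)
    then have "l \<le> 8 * real r"
      using l by linarith
    then have "l\<^sup>2 \<le> (8 * real r)\<^sup>2"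
      using l by (intro power_mono) auto
    then have "real k ^ 3 / (64 * real r ^ 2) \<le> real k ^ 3 / l\<^sup>2"
      using l r(1) by (intro divide_left_mono) (auto simp: power_mult_distrib)
    then have "real k ^ 3 / real r ^ 2 \<le> 64 * (real k ^ 3 / l\<^sup>2)"
      using r(1) by (simp add: field_simps)
    moreover have "0 \<le> real k ^ 3 / l\<^sup>2" "0 \<le> real k"
      by simp_all
    ultimately show ?thesis
      by argo
  qed
  with time have "real (37 * w ^ 3 * (r + 1)) \<le> 40000 * (real k + real k ^ 3 / l\<^sup>2)"
    by linarith
  moreover have "k \<le> (r + 1) * w"
    using rw(1) by simp
  ultimately show ?thesis
    using that w nw unfolding l_def by blast
qed

theorem theorem5p1:
  shows "\<exists>c C1 C2 :: real. c > 0 \<and> C1 > 0 \<and> C2 > 0 \<and>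
    (\<forall>n k :: nat. 0 < k \<and> real k \<le> c * real n \<longrightarrow>
      (\<exists>F. filler_ok n F \<and>
        (\<forall>E. emptier_ok n E \<longrightarrow>
          (\<exists>t :: nat. real t \<le> C2 * (real k + real k ^ 3 / (ln (real n / real k))\<^sup>2) \<and>
                     backlog n (hd (play F E t)) \<ge> C1 * real k))))"
proof (rule exI[of _ "exp (- 16)"], rule exI[of _ "1 / 2"], rule exI[of _ 40000], intro conjI allI impI)
  show "0 < exp (- 16 :: real)" "0 < (1 / 2 :: real)" "0 < (40000 :: real)"
    by simp_all
  fix n k :: nat
  assume k: "0 < k \<and> real k \<le> exp (- 16) * real n"
  then obtain w r where wr: "0 < w" "8 * 4 ^ r * w \<le> n" "k \<le> (r + 1) * w"
    "real (37 * w ^ 3 * (r + 1)) \<le> 40000 * (real k + real k ^ 3 / (ln (real n / real k))\<^sup>2)"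
    using exists_window by metis
  from filler_reaches[OF wr(1,2)] obtain F where F: "filler_ok n F"
    "\<And>E. emptier_ok n E \<Longrightarrow>
      \<exists>t \<le> 37 * w ^ 3 * (r + 1). real ((r + 1) * w) / 2 \<le> backlog n (hd (play F E t))"
    by blast
  have "\<exists>t :: nat. real t \<le> 40000 * (real k + real k ^ 3 / (ln (real n / real k))\<^sup>2)
      \<and> 1 / 2 * real k \<le> backlog n (hd (play F E t))" if "emptier_ok n E" for E
  proof -
    from F(2)[OF that] obtain t where t: "t \<le> 37 * w ^ 3 * (r + 1)"
      "real ((r + 1) * w) / 2 \<le> backlog n (hd (play F E t))"
      by blast
    have "real t \<le> real (37 * w ^ 3 * (r + 1))" "real k \<le> real ((r + 1) * w)"
      using t(1) wr(3) by (simp_all only: of_nat_le_iff)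
    \<comment> \<open>Sites count half units of fill, hence the factor \<open>1 / 2\<close>.\<close>
    then show ?thesis
      using t(2) wr(4) by (intro exI[of _ t]) linarith
  qed
  with F(1) show "\<exists>F. filler_ok n F \<and> (\<forall>E. emptier_ok n E \<longrightarrow>
      (\<exists>t :: nat. real t \<le> 40000 * (real k + real k ^ 3 / (ln (real n / real k))\<^sup>2)
        \<and> 1 / 2 * real k \<le> backlog n (hd (play F E t))))"
    by blast
qed

end
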